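(* Let $K$ be a field, $G$ a group with neutral element $1$, and let the associative algebra $UT_n$ of upper triangular $n\times n$ matrices over $K$ be endowed with any $G$-grading $\Gamma$. Then $$\mathrm{Aut}_G(UT_n)\simeq H_1^\Gamma,\qquad H_1^\Gamma=\{\varphi_a\mid a\in UT_n\text{ invertible and homogeneous of degree }1\}.$$
   Context: A $G$-grading $\Gamma$ on an algebra $A$ is a vector space decomposition $A=\bigoplus_{g\in G}A_g$ with $A_gA_h\subset A_{gh}$ for all $g,h\in G$; nonzero elements of $A_g$ are called homogeneous of degree $g$. $\mathrm{Aut}_G(A)$ is the group of graded automorphisms, i.e. algebra automorphisms $f$ of $A$ with $f(A_g)= A_g$ for all $g\in G$. For an invertible $a\in UT_n$, $\varphi_a:UT_n\to UT_n$ is the inner automorphism $\varphi_a(x)=axa^{-1}$. *)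

theory Defs
  imports
    "HOL-Algebra.Bij"
    "Jordan_Normal_Form.VS_Connect"
begin

section \<open>Group gradings on associative algebras\<close>

text \<open>
  An associative algebra over a field \<open>K\<close> is a \<open>module\<close> record \<open>A\<close> that is both a
  \<open>vectorspace\<close> over \<open>K\<close> and a (not necessarily commutative) \<open>ring\<close>.  The locale \<open>algebra\<close> of
  HOL-Algebra is unsuitable because it requires commutativity.
\<close>

text \<open>
  The components are subspaces, and the sum is direct: each element has exactly one
  decomposition into components, almost all of which vanish.  Decompositions are extensional
  functions on \<open>carrier G\<close>, so that uniqueness is not spoilt by values outside the group.
\<close>

definition homogeneous_decomposition ::
    "('g, 'm) monoid_scheme \<Rightarrow> ('k, 'a, 'c) module_scheme \<Rightarrow> ('g \<Rightarrow> 'a set) \<Rightarrow> 'a \<Rightarrow> ('g \<Rightarrow> 'a) \<Rightarrow> bool"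
  where "homogeneous_decomposition G A \<Gamma> x c \<longleftrightarrow>
    c \<in> (\<Pi>\<^sub>E g\<in>carrier G. \<Gamma> g) \<and>
    finite {g \<in> carrier G. c g \<noteq> \<zero>\<^bsub>A\<^esub>} \<and>
    x = (\<Oplus>\<^bsub>A\<^esub>g\<in>{g \<in> carrier G. c g \<noteq> \<zero>\<^bsub>A\<^esub>}. c g)"

definition is_grading ::
    "('k, 'l) ring_scheme \<Rightarrow> ('g, 'm) monoid_scheme \<Rightarrow> ('k, 'a, 'c) module_scheme \<Rightarrow> ('g \<Rightarrow> 'a set) \<Rightarrow> bool"
  where "is_grading K G A \<Gamma> \<longleftrightarrow>
    (\<forall>g\<in>carrier G. VectorSpace.subspace K (\<Gamma> g) A) \<and>
    (\<forall>x\<in>carrier A. \<exists>!c. homogeneous_decomposition G A \<Gamma> x c) \<and>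
    (\<forall>g\<in>carrier G. \<forall>h\<in>carrier G. \<forall>x\<in>\<Gamma> g. \<forall>y\<in>\<Gamma> h. x \<otimes>\<^bsub>A\<^esub> y \<in> \<Gamma> (g \<otimes>\<^bsub>G\<^esub> h))"

definition homogeneous :: "('a, 'c) ring_scheme \<Rightarrow> ('g \<Rightarrow> 'a set) \<Rightarrow> 'g \<Rightarrow> 'a \<Rightarrow> bool"
  where "homogeneous A \<Gamma> g x \<longleftrightarrow> x \<in> \<Gamma> g \<and> x \<noteq> \<zero>\<^bsub>A\<^esub>"

section \<open>Graded and inner automorphisms\<close>

definition graded_auto ::
    "('k, 'l) ring_scheme \<Rightarrow> ('g, 'm) monoid_scheme \<Rightarrow> ('k, 'a, 'c) module_scheme \<Rightarrow> ('g \<Rightarrow> 'a set) \<Rightarrow> ('a \<Rightarrow> 'a) set"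
  where "graded_auto K G A \<Gamma> =
    {f \<in> Bij (carrier A). f \<in> Ring.ring_hom A A \<and> f \<in> LinearCombinations.module_hom K A A \<and>
      (\<forall>g\<in>carrier G. f ` \<Gamma> g = \<Gamma> g)}"

definition graded_AutoGroup ::
    "('k, 'l) ring_scheme \<Rightarrow> ('g, 'm) monoid_scheme \<Rightarrow> ('k, 'a, 'c) module_scheme \<Rightarrow> ('g \<Rightarrow> 'a set) \<Rightarrow> ('a \<Rightarrow> 'a) monoid"
  where "graded_AutoGroup K G A \<Gamma> = BijGroup (carrier A) \<lparr>carrier := graded_auto K G A \<Gamma>\<rparr>"

definition inner_auto :: "('a, 'c) ring_scheme \<Rightarrow> 'a \<Rightarrow> 'a \<Rightarrow> 'a"
  where "inner_auto A a = (\<lambda>x\<in>carrier A. a \<otimes>\<^bsub>A\<^esub> x \<otimes>\<^bsub>A\<^esub> inv\<^bsub>A\<^esub> a)"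

definition neutral_inner_auto ::
    "('g, 'm) monoid_scheme \<Rightarrow> ('a, 'c) ring_scheme \<Rightarrow> ('g \<Rightarrow> 'a set) \<Rightarrow> ('a \<Rightarrow> 'a) set"
  where "neutral_inner_auto G A \<Gamma> =
    {inner_auto A a | a. a \<in> Units A \<and> homogeneous A \<Gamma> \<one>\<^bsub>G\<^esub> a}"

definition neutral_inner_AutoGroup ::
    "('g, 'm) monoid_scheme \<Rightarrow> ('a, 'c) ring_scheme \<Rightarrow> ('g \<Rightarrow> 'a set) \<Rightarrow> ('a \<Rightarrow> 'a) monoid"
  where "neutral_inner_AutoGroup G A \<Gamma> = BijGroup (carrier A) \<lparr>carrier := neutral_inner_auto G A \<Gamma>\<rparr>"

section \<open>The algebra of upper triangular matrices\<close>

definition UT :: "'k::field itself \<Rightarrow> nat \<Rightarrow> ('k, 'k mat) module"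
  where "UT ty n = module_mat ty n n \<lparr>carrier := {x \<in> carrier_mat n n. upper_triangular x}\<rparr>"

lemma UT_simps [simp]:
  "carrier (UT ty n) = {x \<in> carrier_mat n n. upper_triangular x}"
  "x \<otimes>\<^bsub>UT ty n\<^esub> y = x * y"
  "x \<oplus>\<^bsub>UT ty n\<^esub> y = x + y"
  "\<one>\<^bsub>UT ty n\<^esub> = 1\<^sub>m n"
  "\<zero>\<^bsub>UT ty n\<^esub> = 0\<^sub>m n n"
  "k \<odot>\<^bsub>UT ty n\<^esub> x = k \<cdot>\<^sub>m x"
  by (simp_all add: UT_def module_mat_simps)

lemma upper_triangular_mult:
  fixes x y :: "'k::semiring_0 mat"
  assumes "x \<in> carrier_mat n n" "y \<in> carrier_mat n n" "upper_triangular x" "upper_triangular y"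
  shows "upper_triangular (x * y)"
proof (rule upper_triangularI)
  fix i j
  assume ij: "j < i" "i < dim_row (x * y)"
  have "(x * y) $$ (i, j) = (\<Sum>k = 0..<n. x $$ (i, k) * y $$ (k, j))"
    using assms ij by (auto simp: scalar_prod_def)
  also have "\<dots> = 0"
  proof (rule sum.neutral, rule ballI)
    fix k
    assume "k \<in> {0..<n}"
    then show "x $$ (i, k) * y $$ (k, j) = 0"
      using assms ij by (cases "k < i") (auto simp: upper_triangular_def)
  qed
  finally show "(x * y) $$ (i, j) = 0" .
qed

lemma ring_UT: "ring (UT TYPE('k::field) n)"
proof (rule ringI)
  show "abelian_group (UT TYPE('k) n)"
  proof (rule abelian_groupI)
    fix x assume "x \<in> carrier (UT TYPE('k) n)"
    then show "\<exists>y\<in>carrier (UT TYPE('k) n). y \<oplus>\<^bsub>UT TYPE('k) n\<^esub> x = \<zero>\<^bsub>UT TYPE('k) n\<^esub>"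
      by (intro bexI[of _ "- x"]) (auto simp: upper_triangular_def uminus_l_inv_mat)
  qed (auto simp: upper_triangular_def comm_add_mat assoc_add_mat)
  show "monoid (UT TYPE('k) n)"
    by (rule monoidI) (auto simp: upper_triangular_mult assoc_mult_mat[of _ n n _ n _ n])
qed (auto simp: add_mult_distrib_mat[of _ n n] mult_add_distrib_mat[of _ n n])

lemma vectorspace_UT: "vectorspace class_ring (UT TYPE('k::field) n)"
proof -
  have "module class_ring (UT TYPE('k) n)"
    using ring.is_abelian_group[OF ring_UT]
    by (intro moduleI)
      (auto simp: class_cring.is_cring upper_triangular_def distrib_left distrib_right mult.assoc
        intro!: eq_matI)
  then show ?thesis
    by (simp add: vectorspace_def class_field)
qed

lemma group_graded_AutoGroup:
  assumes "ring A" "vectorspace K A" "is_grading K G A \<Gamma>"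
  shows "group (graded_AutoGroup K G A \<Gamma>)"
proof -
  interpret A: ring A by fact
  interpret V: vectorspace K A by fact
  have sub: "\<Gamma> g \<subseteq> carrier A" if "g \<in> carrier G" for g
    using assms(3) that LinearCombinations.submodule.subset[OF V.is_module]
    unfolding is_grading_def by blast
  have "subgroup (graded_auto K G A \<Gamma>) (BijGroup (carrier A))"
  proof (rule group.subgroupI[OF group_BijGroup])
    show "graded_auto K G A \<Gamma> \<subseteq> carrier (BijGroup (carrier A))"
      by (auto simp: graded_auto_def BijGroup_def)
    have "(\<lambda>x\<in>carrier A. x) \<in> graded_auto K G A \<Gamma>"
    proof -
      have "(\<lambda>x\<in>carrier A. x) ` \<Gamma> g = \<Gamma> g" if "g \<in> carrier G" for g
        using sub[OF that] by (force simp: image_iff)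
      then show ?thesis
        by (auto simp: graded_auto_def id_Bij Ring.ring_hom_def LinearCombinations.module_hom_def)
    qed
    then show "graded_auto K G A \<Gamma> \<noteq> {}" by blast
  next
    fix f assume f: "f \<in> graded_auto K G A \<Gamma>"
    define h where "h = (\<lambda>x\<in>carrier A. inv_into (carrier A) f x)"
    from f have B: "f \<in> Bij (carrier A)" by (simp add: graded_auto_def)
    then have inj: "inj_on f (carrier A)" and im: "f ` carrier A = carrier A"
      by (auto simp: Bij_def bij_betw_def)
    have hf: "h (f x) = x" if "x \<in> carrier A" for x
      using that inj im by (auto simp: h_def)
    have fh: "f (h x) = x" and hc: "h x \<in> carrier A" if "x \<in> carrier A" for x
      using that im by (auto simp: h_def f_inv_into_f inv_into_into)
    have fm: "f (x \<otimes>\<^bsub>A\<^esub> y) = f x \<otimes>\<^bsub>A\<^esub> f y" and fa: "f (x \<oplus>\<^bsub>A\<^esub> y) = f x \<oplus>\<^bsub>A\<^esub> f y"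
      if "x \<in> carrier A" "y \<in> carrier A" for x y
      using f that by (auto simp: graded_auto_def Ring.ring_hom_def)
    have f1: "f \<one>\<^bsub>A\<^esub> = \<one>\<^bsub>A\<^esub>" using f by (auto simp: graded_auto_def Ring.ring_hom_def)
    have fs: "f (k \<odot>\<^bsub>A\<^esub> x) = k \<odot>\<^bsub>A\<^esub> f x" if "k \<in> carrier K" "x \<in> carrier A" for k x
      using f that by (auto simp: graded_auto_def LinearCombinations.module_hom_def)
    have hm: "h (x \<otimes>\<^bsub>A\<^esub> y) = h x \<otimes>\<^bsub>A\<^esub> h y" and ha: "h (x \<oplus>\<^bsub>A\<^esub> y) = h x \<oplus>\<^bsub>A\<^esub> h y"
      if "x \<in> carrier A" "y \<in> carrier A" for x y
      using that hf[of "h x \<otimes>\<^bsub>A\<^esub> h y"] hf[of "h x \<oplus>\<^bsub>A\<^esub> h y"] by (simp_all add: fm fa fh hc)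
    have hs: "h (k \<odot>\<^bsub>A\<^esub> x) = k \<odot>\<^bsub>A\<^esub> h x" if "k \<in> carrier K" "x \<in> carrier A" for k x
      using that hf[of "k \<odot>\<^bsub>A\<^esub> h x"] by (simp add: fs fh hc)
    have h1: "h \<one>\<^bsub>A\<^esub> = \<one>\<^bsub>A\<^esub>" using hf[of "\<one>\<^bsub>A\<^esub>"] by (simp add: f1)
    have hg: "h ` \<Gamma> g = \<Gamma> g" if g: "g \<in> carrier G" for g
    proof -
      have "f ` \<Gamma> g = \<Gamma> g" using f g by (simp add: graded_auto_def)
      moreover have "h ` f ` \<Gamma> g = (\<lambda>x. x) ` \<Gamma> g"
        unfolding image_image using sub[OF g] by (intro image_cong refl hf) blast
      ultimately show ?thesis by simp
    qed
    have "h \<in> graded_auto K G A \<Gamma>"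
      using restrict_inv_into_Bij[OF B]
      by (auto simp: graded_auto_def Ring.ring_hom_def LinearCombinations.module_hom_def hm ha hs h1 hg hc simp flip: h_def)
    then show "inv\<^bsub>BijGroup (carrier A)\<^esub> f \<in> graded_auto K G A \<Gamma>"
      by (simp add: inv_BijGroup[OF B] h_def)
  next
    fix f h assume fh: "f \<in> graded_auto K G A \<Gamma>" "h \<in> graded_auto K G A \<Gamma>"
    have B: "f \<in> Bij (carrier A)" "h \<in> Bij (carrier A)" using fh by (simp_all add: graded_auto_def)
    have c: "f x \<in> carrier A" "h x \<in> carrier A" if "x \<in> carrier A" for x
      using B[THEN Bij_imp_funcset] that by auto
    have g: "compose (carrier A) f h ` \<Gamma> g = \<Gamma> g" if g: "g \<in> carrier G" for g
    proof -
      have "compose (carrier A) f h ` \<Gamma> g = f ` h ` \<Gamma> g"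
        unfolding image_image compose_def using sub[OF g] by (intro image_cong) auto
      then show ?thesis using fh g by (simp add: graded_auto_def)
    qed
    have "compose (carrier A) f h \<in> graded_auto K G A \<Gamma>"
      using fh c g compose_Bij[OF B]
      by (auto simp: graded_auto_def Ring.ring_hom_def LinearCombinations.module_hom_def compose_def)
    then show "f \<otimes>\<^bsub>BijGroup (carrier A)\<^esub> h \<in> graded_auto K G A \<Gamma>"
      using B by (simp add: BijGroup_def)
  qed
  then show ?thesis
    unfolding graded_AutoGroup_def
    by (rule subgroup.subgroup_is_group) (rule group_BijGroup)
qed

end

theory Submission
  imports Defs
begin

text \<open>
  The two groups are equal as sets of maps, so the isomorphism is the identity.  One inclusion is
  formal: the unit matrix and the inverse of a unit of degree one have degree one, hence conjugation
  by such a unit preserves every component.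

  For the other inclusion let \<open>f\<close> be a graded automorphism.  Any automorphism of \<open>UT\<^sub>n\<close> has an
  intertwiner \<open>b\<close>, that is \<open>f x * b = b * x\<close> for all \<open>x\<close>, with nonzero corner entry \<open>b\<^sub>0\<^sub>0\<close>,
  rows and columns being counted from \<open>0\<close> (\<open>UT_intertwiner\<close>).  Comparing components of degree \<open>deg x\<close> on both sides of this equation, the
  component \<open>b\<^sub>1\<close> of degree one of \<open>b\<close> is an intertwiner as well (\<open>intertwiner_proj_one\<close>).  If \<open>b\<^sub>1\<close>
  comes from \<open>f\<close> and \<open>c\<^sub>1\<close> from the inverse of \<open>f\<close>, then \<open>b\<^sub>1 * c\<^sub>1\<close> is central, so it is the scalar
  given by the product of the two corner entries.  Everything thus rests on the corner entry of \<open>b\<^sub>1\<close>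
  being nonzero.

  This is where the grading is understood: a homogeneous element with nonzero corner entry has degree
  one (\<open>corner_eq\<close>), so the corner entry of \<open>b\<close> is that of \<open>b\<^sub>1\<close>.  Consider the map \<open>\<theta>\<close> from \<open>UT\<^sub>n\<close> to
  the group algebra \<open>K[G]\<close> that sends a homogeneous \<open>a\<close> of degree \<open>h\<close> to \<open>a\<^sub>0\<^sub>0 h\<close>.  It is an algebra
  homomorphism, and the claim says that \<open>\<theta> x\<close> is \<open>x\<^sub>0\<^sub>0\<close> times the neutral element, or equivalently
  that \<open>\<theta>\<close> kills every matrix with vanishing corner entry.  A matrix \<open>y\<close> supported in the first row
  satisfies \<open>a * y = a\<^sub>0\<^sub>0 y\<close>, so the coefficients of \<open>\<theta> y\<close> are invariant under left translation by
  the degree of any homogeneous \<open>a\<close> with \<open>a\<^sub>0\<^sub>0 \<noteq> 0\<close>.  If moreover \<open>y * a - a\<^sub>j\<^sub>j y\<close> is in the kernel of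
  \<open>\<theta>\<close> for all \<open>a\<close>, this invariance forces the two characters \<open>a\<^sub>0\<^sub>0\<close> and \<open>a\<^sub>j\<^sub>j\<close> to agree unless
  \<open>\<theta> y = 0\<close>.  They differ for \<open>j > 0\<close>, and descending on \<open>j\<close> disposes of the matrices in the first
  row with vanishing corner entry (\<open>corner_first_row\<close>).
  Other rows are reduced to the first one through a left ideal, spanned by the
  homogeneous components of the matrix unit \<open>e\<^sub>0\<^sub>0\<close>, on which \<open>UT\<^sub>n\<close> acts through \<open>\<theta>\<close>
  (\<open>corner_zero\<close>).
\<close>

section \<open>Homogeneous components\<close>

locale graded_algebra = ring A + V: vectorspace K A + G: group G
  for A :: "('k, 'a, 'c) module_scheme" (structure) and K :: "('k, 'l) ring_scheme"
    and G :: "('g, 'm) monoid_scheme" and \<Gamma> :: "'g \<Rightarrow> 'a set" +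
  assumes grading: "is_grading K G A \<Gamma>"
begin

lemma component_submodule: "g \<in> carrier G \<Longrightarrow> submodule K (\<Gamma> g) A"
  using grading by (simp add: is_grading_def)

lemma component_subset: "g \<in> carrier G \<Longrightarrow> \<Gamma> g \<subseteq> carrier A"
  by (rule submodule.subset[OF component_submodule])

lemma component_carrier: "x \<in> \<Gamma> g \<Longrightarrow> g \<in> carrier G \<Longrightarrow> x \<in> carrier A"
  using component_subset by blast

lemma component_zero [simp]: "g \<in> carrier G \<Longrightarrow> \<zero> \<in> \<Gamma> g"
  by (rule submodule.zero_closed[OF component_submodule])

lemma component_add: "\<lbrakk>g \<in> carrier G; x \<in> \<Gamma> g; y \<in> \<Gamma> g\<rbrakk> \<Longrightarrow> x \<oplus> y \<in> \<Gamma> g"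
  by (rule submodule.m_closed[OF component_submodule])

lemma component_smult: "\<lbrakk>g \<in> carrier G; r \<in> carrier K; x \<in> \<Gamma> g\<rbrakk> \<Longrightarrow> r \<odot> x \<in> \<Gamma> g"
  by (rule submodule.smult_closed[OF component_submodule])

lemma component_mult:
  "\<lbrakk>g \<in> carrier G; h \<in> carrier G; x \<in> \<Gamma> g; y \<in> \<Gamma> h\<rbrakk> \<Longrightarrow> x \<otimes> y \<in> \<Gamma> (g \<otimes>\<^bsub>G\<^esub> h)"
  using grading unfolding is_grading_def by blast

definition proj :: "'g \<Rightarrow> 'a \<Rightarrow> 'a" where
  "proj g x = (THE c. homogeneous_decomposition G A \<Gamma> x c) g"

lemma proj_decomposition:
  assumes "x \<in> carrier A"
  shows "homogeneous_decomposition G A \<Gamma> x (\<lambda>g. proj g x)"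
proof -
  have "\<exists>!c. homogeneous_decomposition G A \<Gamma> x c"
    using grading assms unfolding is_grading_def by blast
  from theI'[OF this] show ?thesis
    by (simp add: proj_def)
qed

lemma proj_closed: "\<lbrakk>x \<in> carrier A; g \<in> carrier G\<rbrakk> \<Longrightarrow> proj g x \<in> \<Gamma> g"
  using proj_decomposition[of x] unfolding homogeneous_decomposition_def by blast

lemma proj_carrier [simp]: "\<lbrakk>x \<in> carrier A; g \<in> carrier G\<rbrakk> \<Longrightarrow> proj g x \<in> carrier A"
  by (rule component_carrier[OF proj_closed])

definition supp :: "'a \<Rightarrow> 'g set" where
  "supp x = {g \<in> carrier G. proj g x \<noteq> \<zero>}"

lemma supp_carrier: "g \<in> supp x \<Longrightarrow> g \<in> carrier G"
  by (simp add: supp_def)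

lemma supp_subset: "supp x \<subseteq> carrier G"
  by (auto simp: supp_def)

lemma finite_supp: "x \<in> carrier A \<Longrightarrow> finite (supp x)"
  using proj_decomposition[of x] unfolding homogeneous_decomposition_def supp_def by blast

lemma finsum_supp: "x \<in> carrier A \<Longrightarrow> (\<Oplus>g\<in>supp x. proj g x) = x"
  using proj_decomposition[of x] unfolding homogeneous_decomposition_def supp_def by metis

text \<open>
  Uniqueness of the decomposition with the sum taken over any finite set containing the support,
  so that the exact support of a sum or a product need not be known.
\<close>

lemma proj_eqI:
  assumes F: "finite F" "F \<subseteq> carrier G"
    and c: "\<And>g. g \<in> carrier G \<Longrightarrow> c g \<in> \<Gamma> g"
    and out: "\<And>g. \<lbrakk>g \<in> carrier G; g \<notin> F\<rbrakk> \<Longrightarrow> c g = \<zero>"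
    and x: "x = (\<Oplus>g\<in>F. c g)" and g: "g \<in> carrier G"
  shows "proj g x = c g"
proof -
  let ?c = "restrict c (carrier G)"
  have cF: "c \<in> F \<rightarrow> carrier A"
    using c F component_carrier by blast
  have xA: "x \<in> carrier A"
    unfolding x by (rule finsum_closed) (use cF in simp)
  have "(\<Oplus>g\<in>{g \<in> carrier G. ?c g \<noteq> \<zero>}. ?c g) = (\<Oplus>g\<in>F. c g)"
    by (rule add.finprod_mono_neutral_cong_left) (use F out cF in auto)
  moreover have "finite {g \<in> carrier G. ?c g \<noteq> \<zero>}"
    by (rule finite_subset[OF _ F(1)]) (use out in auto)
  ultimately have "homogeneous_decomposition G A \<Gamma> x ?c"
    using c by (simp add: homogeneous_decomposition_def x)
  with grading xA have "(THE c. homogeneous_decomposition G A \<Gamma> x c) = ?c"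
    unfolding is_grading_def by (intro the1_equality) blast+
  then show ?thesis using g by (simp add: proj_def)
qed

lemma proj_homogeneous:
  assumes "x \<in> \<Gamma> h" "h \<in> carrier G" "g \<in> carrier G"
  shows "proj g x = (if g = h then x else \<zero>)"
  using assms component_carrier[OF assms(1,2)] by (intro proj_eqI[where F = "{h}"]) auto

lemma proj_add:
  assumes x: "x \<in> carrier A" and y: "y \<in> carrier A" and g: "g \<in> carrier G"
  shows "proj g (x \<oplus> y) = proj g x \<oplus> proj g y"
proof (rule proj_eqI[where F = "supp x \<union> supp y"])
  have "x = (\<Oplus>g\<in>supp x \<union> supp y. proj g x)"
    by (subst (1) finsum_supp[OF x, symmetric], rule add.finprod_mono_neutral_cong_left)
      (use x y finite_supp in \<open>auto simp: supp_def\<close>)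
  moreover have "y = (\<Oplus>g\<in>supp x \<union> supp y. proj g y)"
    by (subst (1) finsum_supp[OF y, symmetric], rule add.finprod_mono_neutral_cong_left)
      (use x y finite_supp in \<open>auto simp: supp_def\<close>)
  moreover have "(\<Oplus>g\<in>supp x \<union> supp y. proj g x \<oplus> proj g y)
      = (\<Oplus>g\<in>supp x \<union> supp y. proj g x) \<oplus> (\<Oplus>g\<in>supp x \<union> supp y. proj g y)"
    by (rule finsum_addf) (use x y in \<open>auto dest: supp_carrier\<close>)
  ultimately show "x \<oplus> y = (\<Oplus>g\<in>supp x \<union> supp y. proj g x \<oplus> proj g y)"
    by simp
qed (use assms finite_supp in \<open>auto simp: component_add proj_closed supp_def\<close>)

lemma proj_mult_left:
  assumes a: "a \<in> \<Gamma> h" "h \<in> carrier G" and x: "x \<in> carrier A" and k: "k \<in> carrier G"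
  shows "proj (h \<otimes>\<^bsub>G\<^esub> k) (a \<otimes> x) = a \<otimes> proj k x"
proof -
  have aA: "a \<in> carrier A"
    by (rule component_carrier[OF a])
  let ?c = "\<lambda>m. a \<otimes> proj (inv\<^bsub>G\<^esub> h \<otimes>\<^bsub>G\<^esub> m) x"
  have inj: "inj_on (\<lambda>k. h \<otimes>\<^bsub>G\<^esub> k) (supp x)"
    by (rule inj_onI) (metis G.Units_l_cancel G.Units_eq a(2) supp_carrier)
  have inv: "inv\<^bsub>G\<^esub> h \<otimes>\<^bsub>G\<^esub> (h \<otimes>\<^bsub>G\<^esub> m) = m" "h \<otimes>\<^bsub>G\<^esub> (inv\<^bsub>G\<^esub> h \<otimes>\<^bsub>G\<^esub> m) = m" if "m \<in> carrier G" for m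
    using that a by (simp_all flip: G.m_assoc)
  have "proj (h \<otimes>\<^bsub>G\<^esub> k) (a \<otimes> x) = ?c (h \<otimes>\<^bsub>G\<^esub> k)"
  proof (rule proj_eqI[where F = "(\<lambda>k. h \<otimes>\<^bsub>G\<^esub> k) ` supp x"])
    show "?c g \<in> \<Gamma> g" if "g \<in> carrier G" for g
      using component_mult[OF a(2) _ a(1) proj_closed, of "inv\<^bsub>G\<^esub> h \<otimes>\<^bsub>G\<^esub> g" x] that a x by (simp add: inv)
    show "?c g = \<zero>" if "g \<in> carrier G" "g \<notin> (\<lambda>k. h \<otimes>\<^bsub>G\<^esub> k) ` supp x" for g
    proof -
      have "inv\<^bsub>G\<^esub> h \<otimes>\<^bsub>G\<^esub> g \<notin> supp x"
        using that inv(2)[of g] by force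
      then show ?thesis using that a aA by (simp add: supp_def)
    qed
    have "a \<otimes> x = (\<Oplus>k\<in>supp x. a \<otimes> proj k x)"
      by (subst (1) finsum_supp[OF x, symmetric], rule finsum_rdistr)
        (use aA x finite_supp in \<open>auto dest: supp_carrier\<close>)
    also have "\<dots> = (\<Oplus>k\<in>supp x. ?c (h \<otimes>\<^bsub>G\<^esub> k))"
      by (rule finsum_cong') (use a aA x in \<open>auto simp: inv dest: supp_carrier\<close>)
    also have "\<dots> = (\<Oplus>g\<in>(\<lambda>k. h \<otimes>\<^bsub>G\<^esub> k) ` supp x. ?c g)"
      by (rule add.finprod_reindex[symmetric]) (use a aA x inj in \<open>auto dest: supp_carrier\<close>)
    finally show "a \<otimes> x = (\<Oplus>g\<in>(\<lambda>k. h \<otimes>\<^bsub>G\<^esub> k) ` supp x. ?c g)" .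
  qed (use a aA x k finite_supp in \<open>auto dest: supp_carrier\<close>)
  then show ?thesis using k by (simp add: inv)
qed

lemma proj_mult_right:
  assumes a: "a \<in> \<Gamma> h" "h \<in> carrier G" and x: "x \<in> carrier A" and k: "k \<in> carrier G"
  shows "proj (k \<otimes>\<^bsub>G\<^esub> h) (x \<otimes> a) = proj k x \<otimes> a"
proof -
  have aA: "a \<in> carrier A"
    by (rule component_carrier[OF a])
  let ?c = "\<lambda>m. proj (m \<otimes>\<^bsub>G\<^esub> inv\<^bsub>G\<^esub> h) x \<otimes> a"
  have inj: "inj_on (\<lambda>k. k \<otimes>\<^bsub>G\<^esub> h) (supp x)"
    by (rule inj_onI) (metis G.right_cancel a(2) supp_carrier)
  have inv: "m \<otimes>\<^bsub>G\<^esub> h \<otimes>\<^bsub>G\<^esub> inv\<^bsub>G\<^esub> h = m" "m \<otimes>\<^bsub>G\<^esub> inv\<^bsub>G\<^esub> h \<otimes>\<^bsub>G\<^esub> h = m" if "m \<in> carrier G" for m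
    using that a by (simp_all add: G.m_assoc)
  have "proj (k \<otimes>\<^bsub>G\<^esub> h) (x \<otimes> a) = ?c (k \<otimes>\<^bsub>G\<^esub> h)"
  proof (rule proj_eqI[where F = "(\<lambda>k. k \<otimes>\<^bsub>G\<^esub> h) ` supp x"])
    show "?c g \<in> \<Gamma> g" if "g \<in> carrier G" for g
      using component_mult[OF _ a(2) proj_closed a(1), of "g \<otimes>\<^bsub>G\<^esub> inv\<^bsub>G\<^esub> h" x] that a x by (simp add: inv)
    show "?c g = \<zero>" if "g \<in> carrier G" "g \<notin> (\<lambda>k. k \<otimes>\<^bsub>G\<^esub> h) ` supp x" for g
    proof -
      have "g \<otimes>\<^bsub>G\<^esub> inv\<^bsub>G\<^esub> h \<notin> supp x"
        using that inv(2)[of g] by force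
      then show ?thesis using that a aA by (simp add: supp_def)
    qed
    have "x \<otimes> a = (\<Oplus>k\<in>supp x. proj k x \<otimes> a)"
      by (subst (1) finsum_supp[OF x, symmetric], rule finsum_ldistr)
        (use aA x finite_supp in \<open>auto dest: supp_carrier\<close>)
    also have "\<dots> = (\<Oplus>k\<in>supp x. ?c (k \<otimes>\<^bsub>G\<^esub> h))"
      by (rule finsum_cong') (use a aA x in \<open>auto simp: inv dest: supp_carrier\<close>)
    also have "\<dots> = (\<Oplus>g\<in>(\<lambda>k. k \<otimes>\<^bsub>G\<^esub> h) ` supp x. ?c g)"
      by (rule add.finprod_reindex[symmetric]) (use a aA x inj in \<open>auto dest: supp_carrier\<close>)
    finally show "x \<otimes> a = (\<Oplus>g\<in>(\<lambda>k. k \<otimes>\<^bsub>G\<^esub> h) ` supp x. ?c g)" .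
  qed (use a aA x k finite_supp in \<open>auto dest: supp_carrier\<close>)
  then show ?thesis using k by (simp add: inv)
qed

lemma homogeneous_induct [consumes 1, case_names homogeneous add]:
  assumes x: "x \<in> carrier A"
    and hom: "\<And>g a. \<lbrakk>g \<in> carrier G; a \<in> \<Gamma> g\<rbrakk> \<Longrightarrow> P a"
    and add: "\<And>y z. \<lbrakk>y \<in> carrier A; z \<in> carrier A; P y; P z\<rbrakk> \<Longrightarrow> P (y \<oplus> z)"
  shows "P x"
proof -
  have "F \<subseteq> carrier G \<Longrightarrow> P (\<Oplus>g\<in>F. proj g x)" if "finite F" for F
    using that
  proof induction
    case empty
    then show ?case using hom[of "\<one>\<^bsub>G\<^esub>" \<zero>] by simp
  next
    case (insert g F)
    then have "(\<Oplus>g\<in>insert g F. proj g x) = proj g x \<oplus> (\<Oplus>g\<in>F. proj g x)"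
      using x by (intro finsum_insert) auto
    moreover have "(\<Oplus>g\<in>F. proj g x) \<in> carrier A"
      using insert x by (intro finsum_closed) auto
    ultimately show ?case
      using insert x hom[of g "proj g x"] proj_closed by (auto intro: add)
  qed
  then show ?thesis
    using finsum_supp[OF x] finite_supp[OF x] supp_subset by metis
qed

lemma proj_nonzero_ex:
  assumes "x \<in> carrier A" "x \<noteq> \<zero>"
  shows "\<exists>g\<in>carrier G. proj g x \<noteq> \<zero>"
proof (rule ccontr)
  assume "\<not> ?thesis"
  then have "supp x = {}" by (auto simp: supp_def)
  then show False using finsum_supp[of x] assms by simp
qed

lemma homogeneousI:
  assumes x: "x \<in> carrier A" and h: "h \<in> carrier G"
    and zero: "\<And>g. \<lbrakk>g \<in> carrier G; g \<noteq> h\<rbrakk> \<Longrightarrow> proj g x = \<zero>"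
  shows "x \<in> \<Gamma> h"
proof -
  have "(\<Oplus>g\<in>supp x. proj g x) = (\<Oplus>g\<in>{h}. proj g x)"
    by (rule add.finprod_mono_neutral_cong_left) (use x h zero in \<open>auto simp: supp_def\<close>)
  then have "x = proj h x"
    using x h by (simp add: finsum_supp)
  then show ?thesis using proj_closed[OF x h] by simp
qed

text \<open>
  For homogeneous \<open>x\<close> the component of \<open>x \<otimes> \<one>\<close> of degree \<open>deg x\<close> is \<open>x\<close> times the degree one part of
  \<open>\<one>\<close>.  So this part is a right unit, and a right unit is \<open>\<one>\<close>.
\<close>

lemma one_homogeneous: "\<one> \<in> \<Gamma> \<one>\<^bsub>G\<^esub>"
proof -
  let ?e = "proj \<one>\<^bsub>G\<^esub> \<one>"
  have "x \<otimes> ?e = x" if "x \<in> carrier A" for x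
    using that
  proof (induction rule: homogeneous_induct)
    case (homogeneous g a)
    then show ?case
      using proj_mult_left[of a g \<one> "\<one>\<^bsub>G\<^esub>"] proj_homogeneous[of a g g] component_carrier[of a g] by simp
  next
    case (add y z)
    then show ?case by (simp add: l_distr)
  qed
  from this[of \<one>] have "?e = \<one>" by simp
  then show ?thesis using proj_closed[of \<one> "\<one>\<^bsub>G\<^esub>"] by simp
qed

text \<open>
  Multiplication by \<open>a\<close> preserves degrees and sends \<open>inv a\<close> to the unit element, which lives in
  degree one; so it annihilates the other components of \<open>inv a\<close>.
\<close>

lemma inv_homogeneous_one:
  assumes a: "a \<in> Units A" "a \<in> \<Gamma> \<one>\<^bsub>G\<^esub>"
  shows "inv a \<in> \<Gamma> \<one>\<^bsub>G\<^esub>"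
proof (rule homogeneousI)
  fix g assume g: "g \<in> carrier G" "g \<noteq> \<one>\<^bsub>G\<^esub>"
  have "a \<otimes> proj g (inv a) = proj g (a \<otimes> inv a)"
    using proj_mult_left[of a "\<one>\<^bsub>G\<^esub>" "inv a" g] a g by simp
  also have "\<dots> = \<zero>"
    using a g one_homogeneous by (simp add: proj_homogeneous)
  finally have zero: "a \<otimes> proj g (inv a) = \<zero>" .
  have "proj g (inv a) = (inv a \<otimes> a) \<otimes> proj g (inv a)"
    using a g by simp
  also have "\<dots> = inv a \<otimes> (a \<otimes> proj g (inv a))"
    using a g by (intro m_assoc) auto
  finally show "proj g (inv a) = \<zero>"
    using a by (simp add: zero)
qed (use a in auto)

lemma proj_zero [simp]: "g \<in> carrier G \<Longrightarrow> proj g \<zero> = \<zero>"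
  using proj_homogeneous[of \<zero> g g] by simp

text \<open>
  For \<open>a\<close> of degree \<open>h\<close> both \<open>f a \<otimes> b\<close> and \<open>b \<otimes> a\<close> have their component of degree \<open>h\<close> determined
  by the component of \<open>b\<close> of degree one, because \<open>h k = h\<close> and \<open>k h = h\<close> both force \<open>k = 1\<close>.
\<close>

lemma intertwiner_proj_one:
  assumes f: "\<And>x. x \<in> carrier A \<Longrightarrow> f x \<in> carrier A"
    and f_add: "\<And>x y. \<lbrakk>x \<in> carrier A; y \<in> carrier A\<rbrakk> \<Longrightarrow> f (x \<oplus> y) = f x \<oplus> f y"
    and f_deg: "\<And>g x. \<lbrakk>g \<in> carrier G; x \<in> \<Gamma> g\<rbrakk> \<Longrightarrow> f x \<in> \<Gamma> g"
    and b: "b \<in> carrier A" and fb: "\<And>x. x \<in> carrier A \<Longrightarrow> f x \<otimes> b = b \<otimes> x"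
    and x: "x \<in> carrier A"
  shows "f x \<otimes> proj \<one>\<^bsub>G\<^esub> b = proj \<one>\<^bsub>G\<^esub> b \<otimes> x"
  using x
proof (induction rule: homogeneous_induct)
  case (homogeneous h a)
  then show ?case
    using proj_mult_left[OF f_deg, of h a b "\<one>\<^bsub>G\<^esub>"] proj_mult_right[of a h b "\<one>\<^bsub>G\<^esub>"] b
      fb[of a] component_carrier[of a h] by simp
next
  case (add y z)
  then show ?case
    using b f by (simp add: f_add l_distr r_distr)
qed

end

section \<open>Upper triangular matrices\<close>

declare UT_simps(1) [simp del]

lemma UT_carrier_iff: "x \<in> carrier (UT ty n) \<longleftrightarrow> x \<in> carrier_mat n n \<and> upper_triangular x"
  by (simp add: UT_simps(1))

lemma UT_carrier_mat: "x \<in> carrier (UT ty n) \<Longrightarrow> x \<in> carrier_mat n n"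
  by (simp add: UT_carrier_iff)

lemma UT_below_diagonal: "\<lbrakk>x \<in> carrier (UT ty n); j < i; i < n\<rbrakk> \<Longrightarrow> x $$ (i, j) = 0"
  by (auto simp: UT_carrier_iff upper_triangular_def)

lemma UT_I:
  "\<lbrakk>x \<in> carrier_mat n n; \<And>i j. \<lbrakk>j < i; i < n\<rbrakk> \<Longrightarrow> x $$ (i, j) = 0\<rbrakk> \<Longrightarrow> x \<in> carrier (UT ty n)"
  by (auto simp: UT_carrier_iff)

lemma UT_mult: "\<lbrakk>x \<in> carrier (UT ty n); y \<in> carrier (UT ty n)\<rbrakk> \<Longrightarrow> x * y \<in> carrier (UT ty n)"
  by (auto simp: UT_carrier_iff intro: upper_triangular_mult)

lemma UT_add: "\<lbrakk>x \<in> carrier (UT ty n); y \<in> carrier (UT ty n)\<rbrakk> \<Longrightarrow> x + y \<in> carrier (UT ty n)"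
  by (auto simp: UT_carrier_iff upper_triangular_def)

lemma UT_smult: "x \<in> carrier (UT ty n) \<Longrightarrow> c \<cdot>\<^sub>m x \<in> carrier (UT ty n)"
  by (auto simp: UT_carrier_iff upper_triangular_def)

lemma UT_one: "1\<^sub>m n \<in> carrier (UT ty n)"
  by (auto simp: UT_carrier_iff upper_triangular_def)

lemma sum_single_term:
  assumes "finite A" "q \<in> A" "\<And>p. \<lbrakk>p \<in> A; p \<noteq> q\<rbrakk> \<Longrightarrow> f p = (0 :: 'b :: comm_monoid_add)"
  shows "sum f A = f q"
  using assms by (simp add: sum.remove[of A q])

lemma index_mult_square:
  "\<lbrakk>x \<in> carrier_mat n n; y \<in> carrier_mat n n; i < n; j < n\<rbrakk>
    \<Longrightarrow> (x * y) $$ (i, j) = (\<Sum>p<n. x $$ (i, p) * y $$ (p, j))"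
  by (auto simp: scalar_prod_def lessThan_atLeast0 intro!: sum.cong)

lemma UT_diagonal_mult:
  assumes x: "x \<in> carrier (UT ty n)" and y: "y \<in> carrier (UT ty n)" and i: "i < n"
  shows "(x * y) $$ (i, i) = x $$ (i, i) * y $$ (i, i)"
proof -
  have "(x * y) $$ (i, i) = (\<Sum>p<n. x $$ (i, p) * y $$ (p, i))"
    using x y i by (intro index_mult_square) (auto simp: UT_carrier_mat)
  also have "\<dots> = x $$ (i, i) * y $$ (i, i)"
  proof (rule sum_single_term)
    show "x $$ (i, p) * y $$ (p, i) = 0" if "p \<in> {..<n}" "p \<noteq> i" for p
      using that x y i by (cases "p < i") (auto simp: UT_below_diagonal)
  qed (use i in auto)
  finally show ?thesis .
qed

lemma nonzero_mat_entry:
  assumes "x \<in> carrier_mat n m" "x \<noteq> 0\<^sub>m n m"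
  obtains i j where "i < n" "j < m" "x $$ (i, j) \<noteq> 0"
proof (rule ccontr)
  assume "\<not> thesis"
  with that have "\<And>i j. \<lbrakk>i < n; j < m\<rbrakk> \<Longrightarrow> x $$ (i, j) = 0" by blast
  then have "x = 0\<^sub>m n m"
    using assms(1) by (intro eq_matI) auto
  with assms(2) show False ..
qed

definition matrix_unit :: "nat \<Rightarrow> nat \<Rightarrow> nat \<Rightarrow> 'a::zero_neq_one mat" where
  "matrix_unit n i j = mat n n (\<lambda>(k, l). if k = i \<and> l = j then 1 else 0)"

lemma matrix_unit_carrier [simp]: "matrix_unit n i j \<in> carrier_mat n n"
  by (simp add: matrix_unit_def)

lemma index_matrix_unit [simp]:
  "\<lbrakk>k < n; l < n\<rbrakk> \<Longrightarrow> matrix_unit n i j $$ (k, l) = (if k = i \<and> l = j then 1 else 0)"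
  by (simp add: matrix_unit_def)

lemma matrix_unit_dim [simp]: "dim_row (matrix_unit n i j) = n" "dim_col (matrix_unit n i j) = n"
  by (simp_all add: matrix_unit_def)

lemma matrix_unit_UT: "\<lbrakk>i \<le> j; j < n\<rbrakk> \<Longrightarrow> matrix_unit n i j \<in> carrier (UT ty n)"
  by (auto intro!: UT_I)

lemma index_matrix_unit_mult:
  fixes x :: "'a::semiring_1 mat"
  assumes "x \<in> carrier_mat n n" "j < n" "k < n" "l < n"
  shows "(matrix_unit n i j * x) $$ (k, l) = (if k = i then x $$ (j, l) else 0)"
proof -
  have "(matrix_unit n i j * x) $$ (k, l) = (\<Sum>p<n. matrix_unit n i j $$ (k, p) * x $$ (p, l))"
    using assms by (intro index_mult_square) auto
  also have "\<dots> = matrix_unit n i j $$ (k, j) * x $$ (j, l)"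
    by (rule sum_single_term) (use assms in auto)
  finally show ?thesis using assms by simp
qed

lemma index_mult_matrix_unit:
  fixes x :: "'a::semiring_1 mat"
  assumes "x \<in> carrier_mat n n" "i < n" "k < n" "l < n"
  shows "(x * matrix_unit n i j) $$ (k, l) = (if l = j then x $$ (k, i) else 0)"
proof -
  have "(x * matrix_unit n i j) $$ (k, l) = (\<Sum>p<n. x $$ (k, p) * matrix_unit n i j $$ (p, l))"
    using assms by (intro index_mult_square) auto
  also have "\<dots> = x $$ (k, i) * matrix_unit n i j $$ (i, l)"
    by (rule sum_single_term) (use assms in auto)
  finally show ?thesis using assms by simp
qed

lemma matrix_unit_mult:
  "\<lbrakk>i < n; j < n; k < n; l < n\<rbrakk> \<Longrightarrow> (matrix_unit n i j * matrix_unit n k l :: 'a::semiring_1 mat)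
    = (if j = k then matrix_unit n i l else 0\<^sub>m n n)"
  by (rule eq_matI) (auto simp del: index_mult_mat(1) simp: index_matrix_unit_mult)

lemma UT_induct [consumes 1, case_names zero unit add]:
  fixes P :: "'k::field mat \<Rightarrow> bool"
  assumes x: "x \<in> carrier (UT TYPE('k) n)"
    and zero: "P (0\<^sub>m n n)"
    and unit: "\<And>c i j. \<lbrakk>i \<le> j; j < n\<rbrakk> \<Longrightarrow> P (c \<cdot>\<^sub>m matrix_unit n i j)"
    and add: "\<And>y z. \<lbrakk>y \<in> carrier (UT TYPE('k) n); z \<in> carrier (UT TYPE('k) n); P y; P z\<rbrakk> \<Longrightarrow> P (y + z)"
  shows "P x"
  using x
proof (induction "card {(i, j). i < n \<and> j < n \<and> x $$ (i, j) \<noteq> 0}" arbitrary: x rule: less_induct)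
  case less
  show ?case
  proof (cases "\<exists>i<n. \<exists>j<n. x $$ (i, j) \<noteq> 0")
    case False
    then have "x = 0\<^sub>m n n"
      using UT_carrier_mat[OF less.prems] by (intro eq_matI) auto
    then show ?thesis using zero by simp
  next
    case True
    then obtain i j where ij: "i < n" "j < n" "x $$ (i, j) \<noteq> 0" by blast
    then have le: "i \<le> j" using UT_below_diagonal[OF less.prems, of j i] by (meson not_less)
    define y where "y = mat n n (\<lambda>(k, l). if k = i \<and> l = j then 0 else x $$ (k, l))"
    have yc: "y \<in> carrier (UT TYPE('k) n)"
      using less.prems by (auto simp: y_def UT_below_diagonal intro!: UT_I)
    have uc: "x $$ (i, j) \<cdot>\<^sub>m matrix_unit n i j \<in> carrier (UT TYPE('k) n)"
      by (intro UT_smult matrix_unit_UT le ij)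
    have "{(k, l). k < n \<and> l < n \<and> y $$ (k, l) \<noteq> 0} \<subset> {(k, l). k < n \<and> l < n \<and> x $$ (k, l) \<noteq> 0}"
    proof (rule psubsetI)
      show "{(k, l). k < n \<and> l < n \<and> y $$ (k, l) \<noteq> 0} \<subseteq> {(k, l). k < n \<and> l < n \<and> x $$ (k, l) \<noteq> 0}"
        by (auto simp: y_def split: if_splits)
      have "(i, j) \<notin> {(k, l). k < n \<and> l < n \<and> y $$ (k, l) \<noteq> 0}"
        using ij by (simp add: y_def)
      then show "{(k, l). k < n \<and> l < n \<and> y $$ (k, l) \<noteq> 0} \<noteq> {(k, l). k < n \<and> l < n \<and> x $$ (k, l) \<noteq> 0}"
        using ij by blast
    qed
    moreover have "finite {(k, l). k < n \<and> l < n \<and> x $$ (k, l) \<noteq> 0}"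
      by (rule finite_subset[of _ "{..<n} \<times> {..<n}"]) auto
    ultimately have "P y" by (intro less.hyps psubset_card_mono yc)
    then have "P (x $$ (i, j) \<cdot>\<^sub>m matrix_unit n i j + y)"
      by (intro add unit uc yc le ij)
    moreover have "x $$ (i, j) \<cdot>\<^sub>m matrix_unit n i j + y = x"
      using UT_carrier_mat[OF less.prems] ij by (intro eq_matI) (auto simp: y_def)
    ultimately show ?thesis by simp
  qed
qed

text \<open>Already commuting with the matrix units \<open>e\<^sub>0\<^sub>j\<close> determines all rows of \<open>z\<close>.\<close>

lemma UT_center_scalar:
  fixes z :: "'k::field mat"
  assumes n: "n \<ge> 1" and z: "z \<in> carrier (UT TYPE('k) n)"
    and comm: "\<And>x. x \<in> carrier (UT TYPE('k) n) \<Longrightarrow> z * x = x * z"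
  shows "z = z $$ (0, 0) \<cdot>\<^sub>m 1\<^sub>m n"
proof (rule eq_matI)
  fix j l assume "j < dim_row (z $$ (0, 0) \<cdot>\<^sub>m 1\<^sub>m n)" "l < dim_col (z $$ (0, 0) \<cdot>\<^sub>m 1\<^sub>m n)"
  then have jl: "j < n" "l < n" by auto
  have "(z * matrix_unit n 0 j) $$ (0, l) = (matrix_unit n 0 j * z) $$ (0, l)"
    using comm[OF matrix_unit_UT[of 0 j n]] jl by simp
  then have "(if l = j then z $$ (0, 0) else 0) = z $$ (j, l)"
    using UT_carrier_mat[OF z] jl n by (simp add: index_matrix_unit_mult index_mult_matrix_unit del: index_mult_mat(1))
  then show "z $$ (j, l) = (z $$ (0, 0) \<cdot>\<^sub>m 1\<^sub>m n) $$ (j, l)"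
    using jl by auto
qed (use UT_carrier_mat[OF z] in auto)

lemma first_row_eigenvector:
  assumes a: "a \<in> carrier (UT ty n)" and y: "y \<in> carrier_mat n n"
    and rows: "\<And>k l. \<lbrakk>0 < k; k < n; l < n\<rbrakk> \<Longrightarrow> y $$ (k, l) = 0"
  shows "a * y = a $$ (0, 0) \<cdot>\<^sub>m y"
proof (rule eq_matI)
  fix k l assume "k < dim_row (a $$ (0, 0) \<cdot>\<^sub>m y)" "l < dim_col (a $$ (0, 0) \<cdot>\<^sub>m y)"
  then have kl: "k < n" "l < n" using y by auto
  have "(a * y) $$ (k, l) = (\<Sum>p<n. a $$ (k, p) * y $$ (p, l))"
    using UT_carrier_mat[OF a] y kl by (rule index_mult_square)
  also have "\<dots> = a $$ (k, 0) * y $$ (0, l)"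
    by (rule sum_single_term) (use kl rows in auto)
  also have "\<dots> = (a $$ (0, 0) \<cdot>\<^sub>m y) $$ (k, l)"
    using kl y rows UT_below_diagonal[OF a, of 0 k] by (cases "k = 0") auto
  finally show "(a * y) $$ (k, l) = (a $$ (0, 0) \<cdot>\<^sub>m y) $$ (k, l)" .
qed (use UT_carrier_mat[OF a] y in auto)

section \<open>Automorphisms of the algebra of upper triangular matrices\<close>

text \<open>
  The last column of \<open>UT\<^sub>n\<close> is a copy of the module of column vectors.  An intertwiner therefore arises
  by fixing a column vector \<open>v\<close> and sending the \<open>i\<close>-th standard vector to \<open>f e\<^sub>i\<^sub>,\<^sub>n\<^sub>-\<^sub>1 v\<close>; its matrix
  consists of these columns.  It is upper triangular because \<open>e\<^sub>i\<^sub>,\<^sub>n\<^sub>-\<^sub>1\<close> is a product of \<open>n - 1 - i\<close>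
  matrix units just above the diagonal, whose images square to zero and hence are strictly upper
  triangular.  The vector \<open>v\<close> is chosen as a standard vector on which \<open>f e\<^sub>0\<^sub>,\<^sub>n\<^sub>-\<^sub>1\<close> does not vanish.
\<close>

lemma UT_intertwiner:
  fixes f :: "'k::field mat \<Rightarrow> 'k mat"
  assumes n: "n \<ge> 1"
    and f: "\<And>x. x \<in> carrier (UT TYPE('k) n) \<Longrightarrow> f x \<in> carrier (UT TYPE('k) n)"
    and f_add: "\<And>x y. \<lbrakk>x \<in> carrier (UT TYPE('k) n); y \<in> carrier (UT TYPE('k) n)\<rbrakk> \<Longrightarrow> f (x + y) = f x + f y"
    and f_mult: "\<And>x y. \<lbrakk>x \<in> carrier (UT TYPE('k) n); y \<in> carrier (UT TYPE('k) n)\<rbrakk> \<Longrightarrow> f (x * y) = f x * f y"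
    and f_smult: "\<And>c x. x \<in> carrier (UT TYPE('k) n) \<Longrightarrow> f (c \<cdot>\<^sub>m x) = c \<cdot>\<^sub>m f x"
    and f_inj: "inj_on f (carrier (UT TYPE('k) n))"
  shows "\<exists>b\<in>carrier (UT TYPE('k) n). b $$ (0, 0) \<noteq> 0 \<and> (\<forall>x\<in>carrier (UT TYPE('k) n). f x * b = b * x)"
proof -
  let ?T = "carrier (UT TYPE('k) n)"
  let ?E = "matrix_unit n :: nat \<Rightarrow> nat \<Rightarrow> 'k mat"
  have fE: "f (?E i j) \<in> ?T" if "i \<le> j" "j < n" for i j
    using that by (intro f matrix_unit_UT)
  have zT: "0\<^sub>m n n \<in> ?T"
    by (auto intro!: UT_I)
  have fz: "f (0\<^sub>m n n) = 0\<^sub>m n n"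
  proof -
    have "f (0 \<cdot>\<^sub>m 0\<^sub>m n n) = 0 \<cdot>\<^sub>m f (0\<^sub>m n n)" by (rule f_smult[OF zT])
    moreover have "0 \<cdot>\<^sub>m f (0\<^sub>m n n) = 0\<^sub>m n n"
      using UT_carrier_mat[OF f[OF zT]] by (intro eq_matI) auto
    ultimately show ?thesis by simp
  qed
  have strict: "f (?E i (Suc i)) $$ (k, k) = 0" if "Suc i < n" "k < n" for i k
  proof -
    have "f (?E i (Suc i)) * f (?E i (Suc i)) = f (?E i (Suc i) * ?E i (Suc i))"
      using that by (intro f_mult[symmetric] matrix_unit_UT) auto
    also have "\<dots> = 0\<^sub>m n n"
      using that by (simp add: matrix_unit_mult fz)
    finally have "f (?E i (Suc i)) $$ (k, k) * f (?E i (Suc i)) $$ (k, k) = 0"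
      using that UT_diagonal_mult[OF fE fE, of i "Suc i" i "Suc i" k] by simp
    then show ?thesis by simp
  qed
  have upper: "f (?E i (n - 1)) $$ (r, m) = 0" if "i < r" "r < n" "m < n" for i r m
  proof -
    have "i \<le> n - 1" using that by simp
    then show ?thesis using that(1,2)
    proof (induction i arbitrary: r rule: inc_induct)
      case base
      then show ?case by simp
    next
      case (step i)
      have i: "Suc i < n" "i \<le> n - 1" "Suc i \<le> n - 1" "n - 1 < n" using step n by auto
      have "f (?E i (n - 1)) = f (?E i (Suc i) * ?E (Suc i) (n - 1))"
        using i by (simp add: matrix_unit_mult)
      also have "\<dots> = f (?E i (Suc i)) * f (?E (Suc i) (n - 1))"
        using i by (intro f_mult matrix_unit_UT) auto
      finally have "f (?E i (n - 1)) $$ (r, m)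
          = (\<Sum>p<n. f (?E i (Suc i)) $$ (r, p) * f (?E (Suc i) (n - 1)) $$ (p, m))"
        using UT_carrier_mat[OF fE[of i "Suc i"]] UT_carrier_mat[OF fE[of "Suc i" "n - 1"]] i step that
        by (simp add: index_mult_square del: index_mult_mat(1))
      also have "\<dots> = 0"
      proof (rule sum.neutral, rule ballI)
        fix p assume p: "p \<in> {..<n}"
        consider "p < r" | "p = r" | "Suc i < p" using step.prems by linarith
        then show "f (?E i (Suc i)) $$ (r, p) * f (?E (Suc i) (n - 1)) $$ (p, m) = 0"
        proof cases
          case 1
          then show ?thesis using UT_below_diagonal[OF fE[of i "Suc i"], of p r] i step.prems by simp
        next
          case 2
          then show ?thesis using strict i p by simp
        next
          case 3
          then show ?thesis using step.IH[of p] p by simp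
        qed
      qed
      finally show ?case .
    qed
  qed
  have nonzero: "f (?E 0 (n - 1)) \<noteq> 0\<^sub>m n n"
  proof
    assume "f (?E 0 (n - 1)) = 0\<^sub>m n n"
    then have "?E 0 (n - 1) = 0\<^sub>m n n"
      using inj_onD[OF f_inj, of "?E 0 (n - 1)" "0\<^sub>m n n"] n zT by (simp add: fz matrix_unit_UT)
    then have "?E 0 (n - 1) $$ (0, n - 1) = 0\<^sub>m n n $$ (0, n - 1)" by simp
    then show False using n by simp
  qed
  obtain r m where rm: "r < n" "m < n" "f (?E 0 (n - 1)) $$ (r, m) \<noteq> 0"
    using nonzero_mat_entry[OF UT_carrier_mat[OF fE[of 0 "n - 1"]] nonzero] n by auto
  then have r: "r = 0" using upper[of 0 r m] by (cases r) auto
  define b where "b = mat n n (\<lambda>(r, i). f (?E i (n - 1)) $$ (r, m))"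
  have b_index: "b $$ (r, i) = f (?E i (n - 1)) $$ (r, m)" if "r < n" "i < n" for r i
    using that by (simp add: b_def)
  have bc: "b \<in> carrier_mat n n" by (simp add: b_def)
  have bT: "b \<in> ?T"
    by (rule UT_I) (use upper rm in \<open>auto simp: b_def\<close>)
  have "f x * b = b * x" if "x \<in> ?T" for x
    using that
  proof (induction rule: UT_induct)
    case zero
    then show ?case using bc by (simp add: fz)
  next
    case (unit c k l)
    have kl: "k < n" "l < n" using unit by auto
    have "f (?E k l) * b = b * ?E k l"
    proof (rule eq_matI)
      fix r i assume "r < dim_row (b * ?E k l)" "i < dim_col (b * ?E k l)"
      then have ri: "r < n" "i < n" using bc by auto
      have i: "i \<le> n - 1" "n - 1 < n" using ri by auto
      have "(f (?E k l) * b) $$ (r, i) = (\<Sum>p<n. f (?E k l) $$ (r, p) * b $$ (p, i))"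
        using UT_carrier_mat[OF fE[OF unit]] bc ri by (rule index_mult_square)
      also have "\<dots> = (\<Sum>p<n. f (?E k l) $$ (r, p) * f (?E i (n - 1)) $$ (p, m))"
        using ri by (intro sum.cong) (auto simp: b_index)
      also have "\<dots> = (f (?E k l) * f (?E i (n - 1))) $$ (r, m)"
        using UT_carrier_mat[OF fE[OF unit]] UT_carrier_mat[OF fE[OF i]] ri(1) rm(2)
        by (rule index_mult_square[symmetric])
      also have "f (?E k l) * f (?E i (n - 1)) = f (?E k l * ?E i (n - 1))"
        using unit i by (intro f_mult[symmetric] matrix_unit_UT) auto
      also have "\<dots> $$ (r, m) = (if i = l then b $$ (r, k) else 0)"
        using kl ri rm i by (auto simp: matrix_unit_mult fz b_index)
      also have "\<dots> = (b * ?E k l) $$ (r, i)"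
        using bc kl ri by (simp add: index_mult_matrix_unit del: index_mult_mat(1))
      finally show "(f (?E k l) * b) $$ (r, i) = (b * ?E k l) $$ (r, i)" .
    qed (use bc UT_carrier_mat[OF fE[OF unit]] in auto)
    then show ?case
      using bc UT_carrier_mat[OF fE[OF unit]] unit f_smult[OF matrix_unit_UT[OF unit]]
      by (simp add: mult_smult_assoc_mat[of _ n n] mult_smult_distrib[of b n n "?E k l" n])
  next
    case (add y z)
    then show ?case
      using bc f[of y] f[of z]
      by (simp add: f_add UT_carrier_mat add_mult_distrib_mat[of _ n n] mult_add_distrib_mat[of b n n y n z])
  qed
  moreover have "b $$ (0, 0) \<noteq> 0" using rm r n by (simp add: b_index)
  ultimately show ?thesis using bT by blast
qed

section \<open>Gradings of the algebra of upper triangular matrices\<close>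

locale graded_UT = graded_algebra "UT TYPE('k) n" "class_ring :: 'k ring" G \<Gamma>
  for G :: "('g, 'm) monoid_scheme" and n :: nat and \<Gamma> :: "'g \<Rightarrow> 'k::field mat set" +
  assumes size: "n \<ge> 1"
begin

abbreviation T :: "'k mat set" where "T \<equiv> carrier (UT TYPE('k) n)"

text \<open>
  The coefficients of the homomorphism \<open>\<theta>\<close> to the group algebra described at the beginning:
  \<open>corner x g\<close> is the coefficient of \<open>g\<close> in \<open>\<theta> x\<close>.
\<close>

definition corner :: "'k mat \<Rightarrow> 'g \<Rightarrow> 'k" where
  "corner x g = proj g x $$ (0, 0)"

lemma corner_mult_left:
  assumes "a \<in> \<Gamma> h" "h \<in> carrier G" "x \<in> T" "k \<in> carrier G"
  shows "corner (a * x) (h \<otimes>\<^bsub>G\<^esub> k) = a $$ (0, 0) * corner x k"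
  using proj_mult_left[OF assms] UT_diagonal_mult[OF component_carrier[OF assms(1,2)] proj_carrier[OF assms(3,4)], of 0] size
  by (simp add: corner_def)

lemma corner_mult_right:
  assumes "a \<in> \<Gamma> h" "h \<in> carrier G" "x \<in> T" "k \<in> carrier G"
  shows "corner (x * a) (k \<otimes>\<^bsub>G\<^esub> h) = corner x k * a $$ (0, 0)"
  using proj_mult_right[OF assms] UT_diagonal_mult[OF proj_carrier[OF assms(3,4)] component_carrier[OF assms(1,2)], of 0] size
  by (simp add: corner_def)

lemma corner_add:
  assumes "x \<in> T" "y \<in> T" "g \<in> carrier G"
  shows "corner (x + y) g = corner x g + corner y g"
  using proj_add[OF assms] UT_carrier_mat[OF proj_carrier[OF assms(1,3)]] UT_carrier_mat[OF proj_carrier[OF assms(2,3)]] size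
  by (simp add: corner_def)

lemma proj_smult:
  assumes x: "x \<in> T" and g: "g \<in> carrier G"
  shows "proj g (c \<cdot>\<^sub>m x) = c \<cdot>\<^sub>m proj g x"
proof -
  have "c \<cdot>\<^sub>m 1\<^sub>m n \<in> \<Gamma> \<one>\<^bsub>G\<^esub>"
    using component_smult[OF _ _ one_homogeneous, of c] by simp
  from proj_mult_left[OF this G.one_closed x g]
  have "proj g (c \<cdot>\<^sub>m 1\<^sub>m n * x) = c \<cdot>\<^sub>m 1\<^sub>m n * proj g x"
    using g by simp
  moreover have "c \<cdot>\<^sub>m 1\<^sub>m n * y = c \<cdot>\<^sub>m y" if "y \<in> T" for y
    using UT_carrier_mat[OF that] by (simp add: mult_smult_assoc_mat[of _ n n])
  ultimately show ?thesis using x g by simp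
qed

lemma corner_smult:
  assumes "x \<in> T" "g \<in> carrier G"
  shows "corner (c \<cdot>\<^sub>m x) g = c * corner x g"
  using proj_smult[OF assms] UT_carrier_mat[OF proj_carrier[OF assms]] size
  by (simp add: corner_def)

lemma corner_one: "g \<in> carrier G \<Longrightarrow> corner (1\<^sub>m n) g = (if g = \<one>\<^bsub>G\<^esub> then 1 else 0)"
  using proj_homogeneous[OF one_homogeneous, of g] size by (simp add: corner_def)

text \<open>
  The element \<open>\<theta> y\<close> is a simultaneous eigenvector: \<open>\<theta> a \<theta> y = a\<^sub>0\<^sub>0 \<theta> y\<close> since \<open>y\<close> lies in the first row,
  and \<open>\<theta> y \<theta> a = a\<^sub>j\<^sub>j \<theta> y\<close> by assumption.  For homogeneous \<open>a\<close> the first equation says that the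
  coefficients of \<open>\<theta> y\<close> are invariant under left translation by the degree of \<open>a\<close> whenever
  \<open>a\<^sub>0\<^sub>0 \<noteq> 0\<close>; comparing one suitable coefficient in the second one then yields \<open>a\<^sub>0\<^sub>0 = a\<^sub>j\<^sub>j\<close>.
\<close>

lemma first_row_diagonal_constant:
  assumes y: "y \<in> T" and rows: "\<And>k l. \<lbrakk>0 < k; k < n; l < n\<rbrakk> \<Longrightarrow> y $$ (k, l) = 0"
    and j: "j < n"
    and right: "\<And>a g. \<lbrakk>a \<in> T; g \<in> carrier G\<rbrakk> \<Longrightarrow> corner (y * a) g = a $$ (j, j) * corner y g"
    and nonzero: "g \<in> carrier G" "corner y g \<noteq> 0"
    and x: "x \<in> T"
  shows "x $$ (j, j) = x $$ (0, 0)"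
proof -
  have left: "a $$ (0, 0) * corner y k = a $$ (0, 0) * corner y (h \<otimes>\<^bsub>G\<^esub> k)"
    if "a \<in> \<Gamma> h" "h \<in> carrier G" "k \<in> carrier G" for a h k
  proof -
    have "a * y = a $$ (0, 0) \<cdot>\<^sub>m y"
      using component_carrier[OF that(1,2)] UT_carrier_mat[OF y] rows by (rule first_row_eigenvector)
    then show ?thesis
      using corner_mult_left[OF that(1,2) y that(3)] corner_smult[OF y, of "h \<otimes>\<^bsub>G\<^esub> k"] that by auto
  qed
  \<comment> \<open>The component of \<open>y\<close> of degree \<open>g\<close> has nonzero corner entry and serves as \<open>a\<close>.\<close>
  have one: "corner y \<one>\<^bsub>G\<^esub> \<noteq> 0"
    using left[OF proj_closed[OF y nonzero(1)] nonzero(1) G.one_closed] nonzero by (simp add: corner_def)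
  show ?thesis
    using x
  proof (induction rule: homogeneous_induct)
    case (homogeneous h a)
    have aT: "a \<in> T" by (rule component_carrier[OF homogeneous(2,1)])
    have right': "corner y k * a $$ (0, 0) = a $$ (j, j) * corner y (k \<otimes>\<^bsub>G\<^esub> h)" if "k \<in> carrier G" for k
      using corner_mult_right[OF homogeneous(2,1) y that] right[OF aT, of "k \<otimes>\<^bsub>G\<^esub> h"] that homogeneous by simp
    show ?case
    proof (cases "a $$ (0, 0) = 0")
      case True
      then show ?thesis
        using right'[of "inv\<^bsub>G\<^esub> h"] homogeneous one by simp
    next
      case False
      then have "corner y h = corner y \<one>\<^bsub>G\<^esub>"
        using left[OF homogeneous(2,1) G.one_closed] homogeneous by simp
      then show ?thesis
        using right'[of "\<one>\<^bsub>G\<^esub>"] homogeneous one by simp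
    qed
  next
    case (add y z)
    then show ?case
      using j size by (simp add: carrier_matD[OF UT_carrier_mat])
  qed
qed

text \<open>
  If \<open>y\<close> is supported in the first row from column \<open>j\<close> on, then \<open>y * a - a\<^sub>j\<^sub>j y\<close> is supported from
  column \<open>j + 1\<close> on.  By descending induction \<open>\<theta>\<close> kills this difference, so the preceding lemma
  applies; its conclusion fails for the matrix unit \<open>e\<^sub>0\<^sub>0\<close> because \<open>j\<close> is positive.
\<close>

lemma corner_first_row:
  assumes "y \<in> T" "\<And>k l. \<lbrakk>0 < k; k < n; l < n\<rbrakk> \<Longrightarrow> y $$ (k, l) = 0"
    and "j \<le> n" "1 \<le> j" "\<And>l. l < j \<Longrightarrow> y $$ (0, l) = 0"
    and "g \<in> carrier G"
  shows "corner y g = 0"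
  using \<open>j \<le> n\<close> assms(1,2,4-)
proof (induction j arbitrary: y g rule: inc_induct)
  case base
  then have "y $$ (k, l) = 0" if "k < n" "l < n" for k l
    using that by (cases "k = 0") auto
  then have "y = 0\<^sub>m n n"
    using UT_carrier_mat[OF base(1)] by (intro eq_matI) auto
  then show ?case
    using proj_zero[OF base(5)] size by (simp add: corner_def)
next
  case (step j)
  note yT = \<open>y \<in> T\<close> and yc = UT_carrier_mat[OF \<open>y \<in> T\<close>]
  show ?case
  proof (rule ccontr)
    assume nonzero: "corner y g \<noteq> 0"
    have right: "corner (y * a) k = a $$ (j, j) * corner y k" if a: "a \<in> T" and k: "k \<in> carrier G" for a k
    proof -
      let ?r = "y * a + (- a $$ (j, j)) \<cdot>\<^sub>m y"
      have ac: "a \<in> carrier_mat n n" by (rule UT_carrier_mat[OF a])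
      have rT: "?r \<in> T" by (intro UT_add UT_mult UT_smult yT a)
      have ya: "(y * a) $$ (i, l) = (\<Sum>p<n. y $$ (i, p) * a $$ (p, l))" if "i < n" "l < n" for i l
        using yc ac that by (rule index_mult_square)
      have "corner ?r k = 0"
      proof (rule step.IH[OF rT])
        show "?r $$ (i, l) = 0" if "0 < i" "i < n" "l < n" for i l
          using that yc ac step.prems(2) by (simp add: ya del: index_mult_mat(1))
        show "?r $$ (0, l) = 0" if l: "l < Suc j" for l
        proof -
          have "(y * a) $$ (0, l) = y $$ (0, l) * a $$ (j, j)"
          proof (cases "l < j")
            case True
            have "y $$ (0, p) * a $$ (p, l) = 0" if "p < n" for p
              using that True step.prems(4) UT_below_diagonal[OF a, of l p] by (cases "p < j") auto
            then have "(\<Sum>p<n. y $$ (0, p) * a $$ (p, l)) = 0"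
              by (intro sum.neutral) auto
            then show ?thesis
              using True step by (simp add: ya del: index_mult_mat(1))
          next
            case False
            then have "l = j" using l by simp
            have "(y * a) $$ (0, j) = (\<Sum>p<n. y $$ (0, p) * a $$ (p, j))"
              using step size by (intro ya) auto
            also have "\<dots> = y $$ (0, j) * a $$ (j, j)"
            proof (rule sum_single_term)
              show "y $$ (0, p) * a $$ (p, j) = 0" if "p \<in> {..<n}" "p \<noteq> j" for p
                using that step.prems(4) UT_below_diagonal[OF a, of j p] by (cases "p < j") auto
            qed (use step in auto)
            finally show ?thesis using \<open>l = j\<close> by simp
          qed
          then show ?thesis using l yc ac step size by (simp del: index_mult_mat(1))
        qed
      qed (use k in auto)
      moreover have "corner ?r k = corner (y * a) k + (- a $$ (j, j)) * corner y k"
        using corner_add[OF UT_mult[OF yT a] UT_smult[OF yT] k] corner_smult[OF yT k] by simp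
      ultimately show ?thesis by simp
    qed
    have "matrix_unit n 0 0 $$ (j, j) = (matrix_unit n 0 0 $$ (0, 0) :: 'k)"
      using step size
      by (intro first_row_diagonal_constant[OF yT step.prems(2) _ right step.prems(5) nonzero] matrix_unit_UT) auto
    then show False using step size by simp
  qed
qed

text \<open>
  Let \<open>w = e\<^sub>0\<^sub>0\<close> and let \<open>w\<^sub>g\<close> be its components.  From \<open>a * w = a\<^sub>0\<^sub>0 w\<close> one gets \<open>a * w\<^sub>g = a\<^sub>0\<^sub>0 w\<^bsub>hg\<^esub>\<close>
  for \<open>a\<close> of degree \<open>h\<close>, so the span of the \<open>w\<^sub>g\<close> is a left ideal on which \<open>x\<close> acts through \<open>\<theta> x\<close>.
  If \<open>\<theta> y \<noteq> 0\<close> then \<open>y * w\<^sub>g \<noteq> 0\<close> for some \<open>g\<close>, and moving a nonzero row \<open>i\<close> of this product to the top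
  gives \<open>(e\<^sub>0\<^sub>i * y) * w\<^sub>g \<noteq> 0\<close>.  But \<open>e\<^sub>0\<^sub>i * y\<close> is supported in the first row outside the corner, so
  \<open>\<theta>\<close> kills it.
\<close>

lemma corner_zero:
  assumes y: "y \<in> T" and y0: "y $$ (0, 0) = 0" and h: "h \<in> carrier G"
  shows "corner y h = 0"
proof (rule ccontr)
  assume nonzero: "corner y h \<noteq> 0"
  let ?w = "matrix_unit n 0 0 :: 'k mat"
  have w: "?w \<in> T" using size by (intro matrix_unit_UT) auto
  have "?w \<noteq> 0\<^sub>m n n"
  proof
    assume "?w = 0\<^sub>m n n"
    then have "?w $$ (0, 0) = 0\<^sub>m n n $$ (0, 0)" by simp
    then show False using size by simp
  qed
  then obtain s where s: "s \<in> carrier G" "proj s ?w \<noteq> 0\<^sub>m n n"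
    using proj_nonzero_ex[OF w] by auto
  \<comment> \<open>Translation by \<open>h\<close> carries \<open>g\<close> to \<open>s\<close>, a degree at which \<open>w\<close> is known not to vanish.\<close>
  define g where "g = inv\<^bsub>G\<^esub> h \<otimes>\<^bsub>G\<^esub> s"
  define u where "u = proj g ?w"
  have g: "g \<in> carrier G" "h \<otimes>\<^bsub>G\<^esub> g = s" using h s by (simp_all add: g_def flip: G.m_assoc)
  have u: "u \<in> T" "u \<in> \<Gamma> g" unfolding u_def using w g proj_closed by simp_all
  have shift: "proj (k \<otimes>\<^bsub>G\<^esub> g) (x * u) = corner x k \<cdot>\<^sub>m proj (k \<otimes>\<^bsub>G\<^esub> g) ?w"
    if x: "x \<in> T" and k: "k \<in> carrier G" for x k
  proof -
    have "proj (k \<otimes>\<^bsub>G\<^esub> g) (x * u) = proj k x * u"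
      using proj_mult_right[OF u(2) g(1) x k] by simp
    also have "\<dots> = proj (k \<otimes>\<^bsub>G\<^esub> g) (proj k x * ?w)"
      using proj_mult_left[OF proj_closed[OF x k] k w g(1)] by (simp add: u_def)
    also have "proj k x * ?w = corner x k \<cdot>\<^sub>m ?w"
      unfolding corner_def using x k by (intro first_row_eigenvector[where ty = "TYPE('k)" and n = n]) auto
    also have "proj (k \<otimes>\<^bsub>G\<^esub> g) \<dots> = corner x k \<cdot>\<^sub>m proj (k \<otimes>\<^bsub>G\<^esub> g) ?w"
      using w g k by (intro proj_smult) auto
    finally show ?thesis .
  qed
  have yu: "y * u \<in> T" by (intro UT_mult y u)
  have "y * u \<noteq> 0\<^sub>m n n"
  proof
    assume "y * u = 0\<^sub>m n n"
    then have "corner y h \<cdot>\<^sub>m proj s ?w = 0\<^sub>m n n"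
      using shift[OF y h] proj_zero[OF s(1)] g s by simp
    moreover have "proj s ?w \<in> carrier_mat n n"
      using w s by (intro UT_carrier_mat[OF proj_carrier])
    moreover from this s(2) obtain i j where "i < n" "j < n" "proj s ?w $$ (i, j) \<noteq> 0"
      by (rule nonzero_mat_entry)
    ultimately show False
      using nonzero by (metis carrier_matD index_smult_mat(1) index_zero_mat(1) mult_eq_0_iff)
  qed
  with UT_carrier_mat[OF yu] obtain i l where il: "i < n" "l < n" "(y * u) $$ (i, l) \<noteq> 0"
    by (rule nonzero_mat_entry)
  let ?z = "matrix_unit n 0 i * y"
  have z: "?z \<in> T" using il y by (intro UT_mult matrix_unit_UT) auto
  have "corner ?z k = 0" if "k \<in> carrier G" for k
  proof (rule corner_first_row[OF z, where j = 1])
    show "?z $$ (p, q) = 0" if "0 < p" "p < n" "q < n" for p q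
      using that UT_carrier_mat[OF y] il by (simp add: index_matrix_unit_mult del: index_mult_mat(1))
    \<comment> \<open>The corner entry of \<open>e\<^sub>0\<^sub>i * y\<close> is \<open>y\<^sub>i\<^sub>0\<close>, below the diagonal unless \<open>i = 0\<close>.\<close>
    show "?z $$ (0, q) = 0" if "q < 1" for q
      using that UT_carrier_mat[OF y] il y0 size UT_below_diagonal[OF y, of 0 i]
      by (cases "i = 0") (auto simp add: index_matrix_unit_mult simp del: index_mult_mat(1))
  qed (use that size in auto)
  then have zero: "proj (k \<otimes>\<^bsub>G\<^esub> g) (?z * u) = 0\<^sub>m n n" if "k \<in> carrier G" for k
    using shift[OF z that] UT_carrier_mat[OF proj_carrier[OF w, of "k \<otimes>\<^bsub>G\<^esub> g"]] that g(1)
    by auto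
  have "?z * u = 0\<^sub>m n n"
  proof (rule ccontr)
    assume "?z * u \<noteq> 0\<^sub>m n n"
    then obtain k where k: "k \<in> carrier G" "proj k (?z * u) \<noteq> 0\<^sub>m n n"
      using proj_nonzero_ex[OF UT_mult[OF z u(1)]] by auto
    then show False
      using zero[of "k \<otimes>\<^bsub>G\<^esub> inv\<^bsub>G\<^esub> g"] g(1) by (simp add: G.m_assoc)
  qed
  moreover have "?z * u = matrix_unit n 0 i * (y * u)"
    using UT_carrier_mat[OF y] UT_carrier_mat[OF u(1)] by (intro assoc_mult_mat) auto
  ultimately have "(matrix_unit n 0 i * (y * u)) $$ (0, l) = 0"
    using il size by simp
  then show False
    using il size UT_carrier_mat[OF yu] by (simp add: index_matrix_unit_mult del: index_mult_mat(1))
qed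

text \<open>Subtracting \<open>x\<^sub>0\<^sub>0\<close> times the unit matrix, which has degree one, makes the corner entry vanish.\<close>

lemma corner_eq:
  assumes x: "x \<in> T" and g: "g \<in> carrier G"
  shows "corner x g = (if g = \<one>\<^bsub>G\<^esub> then x $$ (0, 0) else 0)"
proof -
  let ?c = "x $$ (0, 0)"
  let ?y = "x + (- ?c) \<cdot>\<^sub>m 1\<^sub>m n"
  have "?y \<in> T" by (intro UT_add UT_smult UT_one x)
  moreover have "?y $$ (0, 0) = 0"
    using UT_carrier_mat[OF x] size by simp
  ultimately have "corner ?y g = 0" using g by (rule corner_zero)
  moreover have "corner ?y g = corner x g + (- ?c) * corner (1\<^sub>m n) g"
    using corner_add[OF x UT_smult[OF UT_one] g] corner_smult[OF UT_one g] by simp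
  ultimately show ?thesis using g by (simp add: corner_one)
qed

lemma graded_auto_intertwiner:
  assumes f: "f \<in> graded_auto class_ring G (UT TYPE('k) n) \<Gamma>"
  obtains b where "b \<in> \<Gamma> \<one>\<^bsub>G\<^esub>" "b $$ (0, 0) \<noteq> 0" "\<And>x. x \<in> T \<Longrightarrow> f x * b = b * x"
proof -
  have bij: "f \<in> Bij T" and hom: "f \<in> Ring.ring_hom (UT TYPE('k) n) (UT TYPE('k) n)"
    and lin: "f \<in> LinearCombinations.module_hom class_ring (UT TYPE('k) n) (UT TYPE('k) n)"
    and deg: "\<And>g. g \<in> carrier G \<Longrightarrow> f ` \<Gamma> g = \<Gamma> g"
    using f by (auto simp: graded_auto_def)
  have closed: "f x \<in> T" if "x \<in> T" for x
    by (rule ring_hom_closed[OF hom that])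
  have add: "f (x + y) = f x + f y" if "x \<in> T" "y \<in> T" for x y
    using ring_hom_add[OF hom that] by simp
  have "\<exists>b\<in>T. b $$ (0, 0) \<noteq> 0 \<and> (\<forall>x\<in>T. f x * b = b * x)"
  proof (rule UT_intertwiner)
    show "f (x * y) = f x * f y" if "x \<in> T" "y \<in> T" for x y
      using ring_hom_mult[OF hom that] by simp
    show "f (c \<cdot>\<^sub>m x) = c \<cdot>\<^sub>m f x" if "x \<in> T" for c x
      using lin that by (simp add: LinearCombinations.module_hom_def)
    show "inj_on f T"
      using bij by (simp add: Bij_def bij_betw_def)
  qed (use size closed add in auto)
  then obtain b where b: "b \<in> T" "b $$ (0, 0) \<noteq> 0" "\<And>x. x \<in> T \<Longrightarrow> f x * b = b * x"
    by blast
  show thesis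
  proof (rule that[of "proj \<one>\<^bsub>G\<^esub> b"])
    show "proj \<one>\<^bsub>G\<^esub> b \<in> \<Gamma> \<one>\<^bsub>G\<^esub>"
      by (rule proj_closed[OF b(1) G.one_closed])
    show "proj \<one>\<^bsub>G\<^esub> b $$ (0, 0) \<noteq> 0"
      using corner_eq[OF b(1) G.one_closed] b(2) by (simp add: corner_def)
    show "f x * proj \<one>\<^bsub>G\<^esub> b = proj \<one>\<^bsub>G\<^esub> b * x" if "x \<in> T" for x
    proof -
      have "f y \<in> \<Gamma> g" if "g \<in> carrier G" "y \<in> \<Gamma> g" for g y
        using deg that by blast
      then show ?thesis
        using intertwiner_proj_one[of f b x] closed add b that by simp
    qed
  qed
qed

text \<open>
  Intertwiners \<open>b\<close> of \<open>f\<close> and \<open>c\<close> of its inverse compose to an intertwiner of the identity, which is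
  an element of the centre.  Hence \<open>b * c\<close> and \<open>c * b\<close> are the scalar \<open>b\<^sub>0\<^sub>0 c\<^sub>0\<^sub>0\<close>, and \<open>b\<close> is a unit
  of the algebra of upper triangular matrices.
\<close>

lemma graded_auto_imp_inner:
  assumes f: "f \<in> graded_auto class_ring G (UT TYPE('k) n) \<Gamma>"
  shows "f \<in> neutral_inner_auto G (UT TYPE('k) n) \<Gamma>"
proof -
  let ?A = "UT TYPE('k) n"
  let ?Gr = "graded_AutoGroup class_ring G ?A \<Gamma>"
  interpret Gr: group ?Gr
    by (rule group_graded_AutoGroup[OF ring_UT vectorspace_UT grading])
  have carrier: "carrier ?Gr = graded_auto class_ring G ?A \<Gamma>"
    by (simp add: graded_AutoGroup_def)
  define h where "h = inv\<^bsub>?Gr\<^esub> f"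
  have h: "h \<in> graded_auto class_ring G ?A \<Gamma>"
    using f Gr.inv_closed unfolding carrier h_def by blast
  have fB: "f \<in> Bij T" and hB: "h \<in> Bij T"
    using f h by (simp_all add: graded_auto_def)
  have mult: "u \<otimes>\<^bsub>?Gr\<^esub> v = compose T u v" if "u \<in> Bij T" "v \<in> Bij T" for u v
    using that by (simp add: graded_AutoGroup_def BijGroup_def)
  have one: "\<one>\<^bsub>?Gr\<^esub> = (\<lambda>x\<in>T. x)"
    by (simp add: graded_AutoGroup_def BijGroup_def)
  have fh: "f (h x) = x" and hf: "h (f x) = x" if "x \<in> T" for x
  proof -
    have "compose T f h = (\<lambda>x\<in>T. x)" "compose T h f = (\<lambda>x\<in>T. x)"
      using Gr.r_inv[of f] Gr.l_inv[of f] f carrier mult[OF fB hB] mult[OF hB fB] one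
      by (simp_all add: h_def)
    then show "f (h x) = x" "h (f x) = x"
      using that by (metis compose_eq restrict_apply')+
  qed
  have fT: "f x \<in> T" and hT: "h x \<in> T" if "x \<in> T" for x
    using Bij_imp_funcset[OF fB] Bij_imp_funcset[OF hB] that by auto
  obtain b where b: "b \<in> \<Gamma> \<one>\<^bsub>G\<^esub>" "b $$ (0, 0) \<noteq> 0" "\<And>x. x \<in> T \<Longrightarrow> f x * b = b * x"
    using graded_auto_intertwiner[OF f] by blast
  obtain c where c: "c \<in> \<Gamma> \<one>\<^bsub>G\<^esub>" "c $$ (0, 0) \<noteq> 0" "\<And>x. x \<in> T \<Longrightarrow> h x * c = c * x"
    using graded_auto_intertwiner[OF h] by blast
  have bT: "b \<in> T" and cT: "c \<in> T"
    using component_carrier[OF b(1)] component_carrier[OF c(1)] by simp_all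
  note mats = UT_carrier_mat[OF bT] UT_carrier_mat[OF cT]
  have assoc: "u * v * w = u * (v * w)" if "u \<in> T" "v \<in> T" "w \<in> T" for u v w
    using that by (intro assoc_mult_mat[of _ n n _ n _ n]) (auto simp: UT_carrier_mat)
  have "b * c * x = x * (b * c)" if x: "x \<in> T" for x
  proof -
    have "b * c * x = b * (h x * c)" using assoc[OF bT cT x] c(3)[OF x] by simp
    also have "\<dots> = f (h x) * b * c" using assoc[OF bT hT[OF x] cT] b(3)[OF hT[OF x]] by simp
    finally show ?thesis using assoc[OF x bT cT] by (simp add: fh x)
  qed
  then have "b * c = (b * c) $$ (0, 0) \<cdot>\<^sub>m 1\<^sub>m n"
    by (rule UT_center_scalar[OF size UT_mult[OF bT cT]])
  then have bc: "b * c = (b $$ (0, 0) * c $$ (0, 0)) \<cdot>\<^sub>m 1\<^sub>m n"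
    using UT_diagonal_mult[OF bT cT, of 0] size by simp
  have "c * b * x = x * (c * b)" if x: "x \<in> T" for x
  proof -
    have "c * b * x = c * (f x * b)" using assoc[OF cT bT x] b(3)[OF x] by simp
    also have "\<dots> = h (f x) * c * b" using assoc[OF cT fT[OF x] bT] c(3)[OF fT[OF x]] by simp
    finally show ?thesis using assoc[OF x cT bT] by (simp add: hf x)
  qed
  then have "c * b = (c * b) $$ (0, 0) \<cdot>\<^sub>m 1\<^sub>m n"
    by (rule UT_center_scalar[OF size UT_mult[OF cT bT]])
  then have cb: "c * b = (b $$ (0, 0) * c $$ (0, 0)) \<cdot>\<^sub>m 1\<^sub>m n"
    using UT_diagonal_mult[OF cT bT, of 0] size by (simp add: mult.commute)
  define r where "r = b $$ (0, 0) * c $$ (0, 0)"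
  have r: "inverse r * r = 1" using b(2) c(2) unfolding r_def by (intro left_inverse) simp
  define d where "d = inverse r \<cdot>\<^sub>m c"
  have dT: "d \<in> T" unfolding d_def by (rule UT_smult[OF cT])
  have scale: "inverse r \<cdot>\<^sub>m (r \<cdot>\<^sub>m 1\<^sub>m n) = 1\<^sub>m n"
    by (rule eq_matI) (use r in \<open>auto simp flip: mult.assoc\<close>)
  have "b * d = 1\<^sub>m n" "d * b = 1\<^sub>m n"
    using mats scale bc cb
    by (simp_all add: d_def mult_smult_distrib[of b n n c n] mult_smult_assoc_mat[of c n n b n] flip: r_def)
  then have unit: "b \<in> Units ?A"
    using bT dT by (auto simp: Units_def intro!: bexI[of _ d])
  have "f = inner_auto ?A b"
  proof (rule extensionalityI)
    show "f \<in> extensional T" using fB by (simp add: Bij_def)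
    show "inner_auto ?A b \<in> extensional T" by (simp add: inner_auto_def)
    fix x assume x: "x \<in> T"
    have inv: "inv\<^bsub>?A\<^esub> b \<in> T" "b * inv\<^bsub>?A\<^esub> b = 1\<^sub>m n"
      using Units_inv_closed[OF unit] Units_r_inv[OF unit] by simp_all
    have "inner_auto ?A b x = b * x * inv\<^bsub>?A\<^esub> b"
      using x by (simp add: inner_auto_def)
    also have "\<dots> = f x * (b * inv\<^bsub>?A\<^esub> b)"
      using b(3)[OF x] assoc[OF fT[OF x] bT inv(1)] by simp
    also have "\<dots> = f x"
      using UT_carrier_mat[OF fT[OF x]] by (simp add: inv(2))
    finally show "f x = inner_auto ?A b x" by simp
  qed
  moreover have "b \<noteq> 0\<^sub>m n n" using b(2) size by auto
  ultimately show ?thesis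
    using unit b(1) by (auto simp: neutral_inner_auto_def homogeneous_def)
qed

lemma inner_imp_graded_auto:
  assumes a: "a \<in> Units (UT TYPE('k) n)" "a \<in> \<Gamma> \<one>\<^bsub>G\<^esub>"
  shows "inner_auto (UT TYPE('k) n) a \<in> graded_auto class_ring G (UT TYPE('k) n) \<Gamma>"
proof -
  let ?A = "UT TYPE('k) n"
  define c where "c = inv\<^bsub>?A\<^esub> a"
  let ?f = "inner_auto ?A a"
  have aT: "a \<in> T" and cT: "c \<in> T"
    using a Units_inv_closed[OF a(1)] by (auto simp: c_def)
  have ac: "a * c = 1\<^sub>m n" and ca: "c * a = 1\<^sub>m n"
    using Units_r_inv[OF a(1)] Units_l_inv[OF a(1)] by (simp_all add: c_def)
  have c1: "c \<in> \<Gamma> \<one>\<^bsub>G\<^esub>"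
    unfolding c_def by (rule inv_homogeneous_one[OF a])
  have assoc: "u * v * w = u * (v * w)" if "u \<in> T" "v \<in> T" "w \<in> T" for u v w
    using that by (intro assoc_mult_mat[of _ n n _ n _ n]) (auto simp: UT_carrier_mat)
  have unit: "1\<^sub>m n * u = u" "u * 1\<^sub>m n = u" if "u \<in> T" for u
    using UT_carrier_mat[OF that] by simp_all
  have f: "?f x = a * x * c" if "x \<in> T" for x
    using that by (simp add: inner_auto_def c_def)
  have fT: "a * x * c \<in> T" if "x \<in> T" for x
    using that by (intro UT_mult aT cT)
  have cancel: "c * (a * x * c) * a = x" and cancel': "a * (c * x * a) * c = x" if x: "x \<in> T" for x
  proof -
    have "c * (a * x * c) * a = (c * a) * x * (c * a)"
      using x by (simp add: assoc UT_mult aT cT)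
    then show "c * (a * x * c) * a = x" using x by (simp add: ca unit)
    have "a * (c * x * a) * c = (a * c) * x * (a * c)"
      using x by (simp add: assoc UT_mult aT cT)
    then show "a * (c * x * a) * c = x" using x by (simp add: ac unit)
  qed
  have cxa: "c * x * a \<in> T" if "x \<in> T" for x
    using that by (intro UT_mult aT cT)
  have "bij_betw ?f T T"
    by (rule bij_betwI[where g = "\<lambda>x. c * x * a"]) (use f fT cxa cancel cancel' in auto)
  then have bij: "?f \<in> Bij T"
    by (simp add: Bij_def inner_auto_def)
  have "?f \<in> Ring.ring_hom ?A ?A"
  proof (rule ring_hom_memI)
    fix x y assume xy: "x \<in> T" "y \<in> T"
    have "(a * x * c) * (a * y * c) = a * x * ((c * a) * y) * c"
      using xy by (simp add: assoc UT_mult aT cT)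
    then show "?f (x \<otimes>\<^bsub>?A\<^esub> y) = ?f x \<otimes>\<^bsub>?A\<^esub> ?f y"
      using xy by (simp add: f UT_mult ca unit assoc aT cT)
    show "?f (x \<oplus>\<^bsub>?A\<^esub> y) = ?f x \<oplus>\<^bsub>?A\<^esub> ?f y"
    proof -
      have "a * (x + y) * c = (a * x + a * y) * c"
        using xy UT_carrier_mat[OF aT] by (simp add: UT_carrier_mat mult_add_distrib_mat[of a n n x n y])
      also have "\<dots> = a * x * c + a * y * c"
        using UT_carrier_mat[OF UT_mult[OF aT xy(1)]] UT_carrier_mat[OF UT_mult[OF aT xy(2)]] UT_carrier_mat[OF cT]
        by (rule add_mult_distrib_mat)
      finally show ?thesis using xy by (simp add: f UT_add)
    qed
  next
    show "?f \<one>\<^bsub>?A\<^esub> = \<one>\<^bsub>?A\<^esub>"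
      by (simp add: f UT_one unit aT ac)
  qed (use f fT in auto)
  moreover have "?f \<in> LinearCombinations.module_hom class_ring ?A ?A"
  proof -
    have "a * (r \<cdot>\<^sub>m x) * c = r \<cdot>\<^sub>m (a * x * c)" if x: "x \<in> T" for r x
      using UT_carrier_mat[OF aT] UT_carrier_mat[OF x] UT_carrier_mat[OF cT]
      by (simp add: mult_smult_distrib[of a n n x n] mult_smult_assoc_mat[of "a * x" n n c n])
    then show ?thesis
      using \<open>?f \<in> Ring.ring_hom ?A ?A\<close>
      by (auto simp: LinearCombinations.module_hom_def Ring.ring_hom_def f UT_smult)
  qed
  moreover have "?f ` \<Gamma> g = \<Gamma> g" if g: "g \<in> carrier G" for g
  proof
    have sub: "a * x * c \<in> \<Gamma> g" "c * x * a \<in> \<Gamma> g" if x: "x \<in> \<Gamma> g" for x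
      using component_mult[OF _ _ component_mult[OF _ g a(2) x] c1]
        component_mult[OF _ _ component_mult[OF _ g c1 x] a(2)] g by simp_all
    have T: "x \<in> T" if "x \<in> \<Gamma> g" for x
      by (rule component_carrier[OF that g])
    show "?f ` \<Gamma> g \<subseteq> \<Gamma> g"
      using sub T by (auto simp: f)
    show "\<Gamma> g \<subseteq> ?f ` \<Gamma> g"
    proof
      fix x assume x: "x \<in> \<Gamma> g"
      then have "x = ?f (c * x * a)"
        using T by (simp add: f cxa cancel')
      then show "x \<in> ?f ` \<Gamma> g" using sub(2)[OF x] by blast
    qed
  qed
  ultimately show ?thesis using bij by (simp add: graded_auto_def)
qed

lemma graded_auto_eq_inner:
  "graded_auto class_ring G (UT TYPE('k) n) \<Gamma> = neutral_inner_auto G (UT TYPE('k) n) \<Gamma>"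
proof
  show "graded_auto class_ring G (UT TYPE('k) n) \<Gamma> \<subseteq> neutral_inner_auto G (UT TYPE('k) n) \<Gamma>"
    using graded_auto_imp_inner by blast
  show "neutral_inner_auto G (UT TYPE('k) n) \<Gamma> \<subseteq> graded_auto class_ring G (UT TYPE('k) n) \<Gamma>"
    using inner_imp_graded_auto by (auto simp: neutral_inner_auto_def homogeneous_def)
qed

end

section \<open>Graded automorphisms are conjugations in degree one\<close>

theorem proposition2:
  fixes G :: "('g, 'm) monoid_scheme"
    and n :: nat
    and \<Gamma> :: "'g \<Rightarrow> 'k::field mat set"
  assumes "n \<ge> 1"
    and "group G"
    and "is_grading class_ring G (UT TYPE('k) n) \<Gamma>"
  shows "graded_AutoGroup class_ring G (UT TYPE('k) n) \<Gamma>
    \<cong> neutral_inner_AutoGroup G (UT TYPE('k) n) \<Gamma>"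
proof -
  interpret graded_UT G n \<Gamma>
    by (intro graded_UT.intro graded_algebra.intro graded_algebra_axioms.intro graded_UT_axioms.intro
        ring_UT vectorspace_UT assms)
  show ?thesis
    unfolding graded_AutoGroup_def neutral_inner_AutoGroup_def graded_auto_eq_inner
    by (rule iso_refl)
qed

end
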